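(* Let $P$ be a second order finite differences operator, determined by a function $\overline{P}:\mathbb{R}^5\times(0,\infty)\to\mathbb{R}$, $(x,v_-,v_+,w,t,\xi)\mapsto \overline{P}(x,v_-,v_+,w,t,\xi)$. The following are equivalent. (i) The equation associated with $P$ can be written as a second order discrete Euler-Lagrange equation, i.e. there exists a couple of Lagrangians $(L_-,L_+)$, $L_\pm:\mathbb{R}^3\times(0,\infty)\to\mathbb{R}$, $(x,v,t,\xi)\mapsto L_\pm(x,v,t,\xi)$, such that for every $\boldsymbol{T}\in\mathbb{T}$, every $\boldsymbol{Q}\in\mathbb{R}^{N+1}$ and every $p=1,\dots,N-1$, $$P^{\boldsymbol{T}}_p(\boldsymbol{Q})=\frac{\partial L_-}{\partial x}(\ast_p)+\frac{\partial L_+}{\partial x}(\ast\ast_p)+\Delta_+\Big(\frac{\partial L_-}{\partial v}(\ast)\Big)_p-\Delta_-\Big(\frac{\partial L_+}{\partial v}(\ast\ast)\Big)_p .$$ (ii) $P$ satisfies the discrete Helmholtz condition: for every $\boldsymbol{T}\in\mathbb{T}$, every $\boldsymbol{Q}\in\mathbb{R}^{N+1}$ and every $p=2,\dots,N-1$, $$\Delta_-\Big(\frac{\partial \overline{P}}{\partial w}(\star)\Big)_p=\frac{\partial \overline{P}}{\partial v_-}(\star_p)+\frac{\partial \overline{P}}{\partial v_+}(\star_{p-1}).$$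
   Context: $\mathbb{T}$ is the set of all $\boldsymbol{T}=(t_p)_{p=0,\dots,N}\in\mathbb{R}^{N+1}$, with $N\ge 4$ an integer, for which there is $h>0$ with $t_{i+1}-t_i=h$ for all $i=0,\dots,N-1$. Both $N$ and $h$ depend on $\boldsymbol{T}$. Discrete derivatives: for a finite sequence $\boldsymbol{F}$, $(\Delta_-\boldsymbol{F})_p=\frac{F_p-F_{p-1}}{h}$ and $(\Delta_+\boldsymbol{F})_p=\frac{F_p-F_{p+1}}{h}$, for every index $p$ for which the entries involved are defined. In particular, for $\boldsymbol{Q}\in\mathbb{R}^{N+1}$ (indexed by $0,\dots,N$), $(-\Delta_+\boldsymbol{Q})_p=\frac{Q_{p+1}-Q_p}{h}$ and $(-\Delta_+\circ\Delta_-\boldsymbol{Q})_p=\frac{Q_{p+1}-2Q_p+Q_{p-1}}{h^2}$. A second order finite differences operator $P$ assigns to each $\boldsymbol{T}\in\mathbb{T}$ the map $P^{\boldsymbol{T}}:\mathbb{R}^{N+1}\to\mathbb{R}^{N-1}$, $P^{\boldsymbol{T}}(\boldsymbol{Q})=(P^{\boldsymbol{T}}_p(\boldsymbol{Q}))_{p=1,\dots,N-1}$, with $P^{\boldsymbol{T}}_p(\boldsymbol{Q})=\overline{P}(\star_p)$, where $$\star_p:=\big(Q_p,(\Delta_-\boldsymbol{Q})_p,(-\Delta_+\boldsymbol{Q})_p,(-\Delta_+\circ\Delta_-\boldsymbol{Q})_p,t_p,h\big),\quad p=1,\dots,N-1,$$ and $\overline{P}$ is one function independent of $\boldsymbol{T}$.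 The expression $\frac{\partial\overline{P}}{\partial w}(\star)$ denotes the sequence $\big(\frac{\partial\overline{P}}{\partial w}(\star_p)\big)_{p=1,\dots,N-1}$. Also $\ast_p:=(Q_p,(\Delta_-\boldsymbol{Q})_p,t_p,h)$ for $p=1,\dots,N$ and $\ast\ast_p:=(Q_p,(-\Delta_+\boldsymbol{Q})_p,t_p,h)$ for $p=0,\dots,N-1$; $\frac{\partial L_-}{\partial v}(\ast)$ and $\frac{\partial L_+}{\partial v}(\ast\ast)$ denote the corresponding sequences. Standing assumption: $\overline{P}$, $L_-$, $L_+$ are sufficiently smooth (for definiteness, $C^\infty$). *)

theory Defs
  imports "HOL-Analysis.Analysis"
begin

(* C^k on an open set. Continuity of all iterated directional derivatives up to order k is the
   usual notion because the domain is finite-dimensional. *)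
primrec Ck_on :: "nat \<Rightarrow> 'a::euclidean_space set \<Rightarrow> ('a \<Rightarrow> real) \<Rightarrow> bool" where
  "Ck_on 0 S f \<longleftrightarrow> continuous_on S f"
| "Ck_on (Suc k) S f \<longleftrightarrow>
     (\<forall>x\<in>S. f differentiable (at x)) \<and> (\<forall>v. Ck_on k S (\<lambda>x. frechet_derivative f (at x) v))"

definition smooth_on :: "'a::euclidean_space set \<Rightarrow> ('a \<Rightarrow> real) \<Rightarrow> bool" where
  "smooth_on S f \<longleftrightarrow> (\<forall>k. Ck_on k S f)"

(* The domains R^5 x (0,oo) and R^3 x (0,oo). Functions on them are total HOL functions whose
   values at nonpositive step size are never used. *)
definition dom_P :: "(real \<times> real \<times> real \<times> real \<times> real \<times> real) set" where
  "dom_P = {(x, vm, vp, w, t, \<xi>). \<xi> > 0}"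

definition dom_L :: "(real \<times> real \<times> real \<times> real) set" where
  "dom_L = {(x, v, t, \<xi>). \<xi> > 0}"

definition dP_dvm ::
  "(real \<times> real \<times> real \<times> real \<times> real \<times> real \<Rightarrow> real) \<Rightarrow> real \<times> real \<times> real \<times> real \<times> real \<times> real \<Rightarrow> real" where
  "dP_dvm P = (\<lambda>(x, vm, vp, w, t, \<xi>). deriv (\<lambda>y. P (x, y, vp, w, t, \<xi>)) vm)"

definition dP_dvp ::
  "(real \<times> real \<times> real \<times> real \<times> real \<times> real \<Rightarrow> real) \<Rightarrow> real \<times> real \<times> real \<times> real \<times> real \<times> real \<Rightarrow> real" where
  "dP_dvp P = (\<lambda>(x, vm, vp, w, t, \<xi>). deriv (\<lambda>y. P (x, vm, y, w, t, \<xi>)) vp)"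

definition dP_dw ::
  "(real \<times> real \<times> real \<times> real \<times> real \<times> real \<Rightarrow> real) \<Rightarrow> real \<times> real \<times> real \<times> real \<times> real \<times> real \<Rightarrow> real" where
  "dP_dw P = (\<lambda>(x, vm, vp, w, t, \<xi>). deriv (\<lambda>y. P (x, vm, vp, y, t, \<xi>)) w)"

definition dL_dx ::
  "(real \<times> real \<times> real \<times> real \<Rightarrow> real) \<Rightarrow> real \<times> real \<times> real \<times> real \<Rightarrow> real" where
  "dL_dx L = (\<lambda>(x, v, t, \<xi>). deriv (\<lambda>y. L (y, v, t, \<xi>)) x)"

definition dL_dv ::
  "(real \<times> real \<times> real \<times> real \<Rightarrow> real) \<Rightarrow> real \<times> real \<times> real \<times> real \<Rightarrow> real" where
  "dL_dv L = (\<lambda>(x, v, t, \<xi>). deriv (\<lambda>y. L (x, y, t, \<xi>)) v)"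

(* Elements of R^{N+1} are functions on nat of which only the entries 0..N matter. *)
definition uniform_grid :: "nat \<Rightarrow> real \<Rightarrow> (nat \<Rightarrow> real) \<Rightarrow> bool" where
  "uniform_grid N h t \<longleftrightarrow> N \<ge> 4 \<and> h > 0 \<and> (\<forall>i<N. t (i + 1) - t i = h)"

(* Only meaningful for p \<ge> 1, since subtraction on nat is truncated. *)
definition Delta_minus :: "real \<Rightarrow> (nat \<Rightarrow> real) \<Rightarrow> nat \<Rightarrow> real" where
  "Delta_minus h F p = (F p - F (p - 1)) / h"

(* With this sign convention, - Delta_plus is the usual forward difference quotient. *)
definition Delta_plus :: "real \<Rightarrow> (nat \<Rightarrow> real) \<Rightarrow> nat \<Rightarrow> real" where
  "Delta_plus h F p = (F p - F (p + 1)) / h"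

definition star ::
  "real \<Rightarrow> (nat \<Rightarrow> real) \<Rightarrow> (nat \<Rightarrow> real) \<Rightarrow> nat \<Rightarrow> real \<times> real \<times> real \<times> real \<times> real \<times> real" where
  "star h t Q p =
     (Q p, Delta_minus h Q p, - Delta_plus h Q p, - Delta_plus h (Delta_minus h Q) p, t p, h)"

definition ast :: "real \<Rightarrow> (nat \<Rightarrow> real) \<Rightarrow> (nat \<Rightarrow> real) \<Rightarrow> nat \<Rightarrow> real \<times> real \<times> real \<times> real" where
  "ast h t Q p = (Q p, Delta_minus h Q p, t p, h)"

definition astast :: "real \<Rightarrow> (nat \<Rightarrow> real) \<Rightarrow> (nat \<Rightarrow> real) \<Rightarrow> nat \<Rightarrow> real \<times> real \<times> real \<times> real" where
  "astast h t Q p = (Q p, - Delta_plus h Q p, t p, h)"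

definition fd_operator ::
  "(real \<times> real \<times> real \<times> real \<times> real \<times> real \<Rightarrow> real) \<Rightarrow> real \<Rightarrow> (nat \<Rightarrow> real) \<Rightarrow> (nat \<Rightarrow> real) \<Rightarrow> nat \<Rightarrow> real" where
  "fd_operator Pbar h t Q p = Pbar (star h t Q p)"

end

(* Each value of P depends on three consecutive points a, b, c of Q; viewing P as a function
   F(a, b, c, t, h) of them, the Helmholtz condition says exactly that
   F_a(b, c, d, t + h, h) = F_c(a, b, c, t, h).  If F comes from Lagrangians, then
   F(a, b, c, t, h) = R_b(b, c, t, h) + R_c(a, b, t - h, h) for the contribution R of one grid step
   to the discrete action, and the Helmholtz condition is the symmetry of the mixed partial
   derivatives of R.  Conversely, the Helmholtz condition makes F_c independent of a, so that
   F(a, b, c) = F(0, b, c) + F(a, b, 0) - F(0, b, 0), and these two parts are the partial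
   derivatives of R(b, c, t, h) = integral of F(0, s, c, t, h) over s from 0 to b;
   thus L_- = 0 and L_+(x, v, t, xi) = R(x, x + xi v, t, xi) do the job. *)
theory Submission
  imports Defs
begin

subsection \<open>Calculus of smooth functions\<close>

lemma Ck_on_imp_continuous_on:
  "Ck_on k S f \<Longrightarrow> continuous_on S f"
  by (cases k) (auto intro!: differentiable_imp_continuous_on differentiable_at_imp_differentiable_on)

lemma Ck_on_SucD: "Ck_on (Suc k) S f \<Longrightarrow> Ck_on k S f"
proof (induction k arbitrary: f)
  case 0
  then show ?case using Ck_on_imp_continuous_on by (simp del: Ck_on.simps(2))
next
  case (Suc k)
  from Suc.prems have "\<forall>x\<in>S. f differentiable (at x)"
    and "\<And>v. Ck_on (Suc k) S (\<lambda>x. frechet_derivative f (at x) v)"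
    by (subst (asm) Ck_on.simps(2), blast)+
  with Suc.IH show ?case by (subst Ck_on.simps(2)) blast
qed

text \<open>On an open set the derivative at a point sees only nearby values, all inside the set, so
  agreement passes to derivatives of every order.\<close>

lemma Ck_on_cong:
  assumes "open S" "\<And>x. x \<in> S \<Longrightarrow> f x = g x" "Ck_on k S f"
  shows "Ck_on k S g"
  using assms(2,3)
proof (induction k arbitrary: f g)
  case 0
  then show ?case by (simp cong: continuous_on_cong)
next
  case (Suc k)
  have fd: "f differentiable (at x)" if "x \<in> S" for x using Suc.prems(2) that by simp
  have "g differentiable (at x)" if "x \<in> S" for x
    using has_derivative_transform_within_open[where s=S and x=x and t=UNIV and f=f and g=g,
        OF _ assms(1) that Suc.prems(1)]
      fd[OF that] unfolding differentiable_def by blast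
  moreover have "frechet_derivative f (at x) = frechet_derivative g (at x)" if "x \<in> S" for x
    using frechet_derivative_transform_within_open[OF fd[OF that] assms(1) that Suc.prems(1)] .
  then have "Ck_on k S (\<lambda>x. frechet_derivative g (at x) v)" for v
    using Suc.IH[of "\<lambda>x. frechet_derivative f (at x) v"] Suc.prems(2) by simp
  ultimately show ?case by simp
qed

text \<open>This is the entry point of the inductions on \<open>k\<close> below: uniqueness of the
  derivative allows any explicit formula \<open>D\<close> in place of
  \<open>frechet_derivative\<close>.\<close>

lemma Ck_on_SucI:
  assumes "open S" "\<And>x. x \<in> S \<Longrightarrow> (f has_derivative D x) (at x)"
    and "\<And>v. Ck_on k S (\<lambda>x. D x v)"
  shows "Ck_on (Suc k) S f"
proof -
  have "frechet_derivative f (at x) = D x" if "x \<in> S" for x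
    using frechet_derivative_at[OF assms(2)[OF that]] by simp
  then have "Ck_on k S (\<lambda>x. frechet_derivative f (at x) v)" for v
    using Ck_on_cong[OF assms(1) _ assms(3)[of v]] by simp
  then show ?thesis using assms(2) by (auto simp: differentiable_def)
qed

lemma Ck_on_has_derivative:
  assumes "Ck_on (Suc k) S f" "x \<in> S"
  shows "(f has_derivative frechet_derivative f (at x)) (at x)"
  using assms by (simp add: frechet_derivative_works)

lemma Ck_on_frechet: "Ck_on (Suc k) S f \<Longrightarrow> Ck_on k S (\<lambda>x. frechet_derivative f (at x) v)"
  by simp

lemma Ck_on_const: "open S \<Longrightarrow> Ck_on k S (\<lambda>x. c)"
proof (induction k arbitrary: c)
  case (Suc k)
  show ?case
    by (rule Ck_on_SucI[OF Suc.prems, where D="\<lambda>_ _. 0"]) (use Suc in auto)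
qed simp

lemma Ck_on_bounded_linear:
  assumes "open S" "bounded_linear f"
  shows "Ck_on k S f"
proof (cases k)
  case 0
  with assms show ?thesis by (simp add: linear_continuous_on)
next
  case (Suc j)
  show ?thesis unfolding Suc
    by (rule Ck_on_SucI[OF assms(1), where D="\<lambda>_. f"])
      (use assms in \<open>auto intro: bounded_linear_imp_has_derivative Ck_on_const\<close>)
qed

lemma Ck_on_add:
  assumes "open S" "Ck_on k S f" "Ck_on k S g"
  shows "Ck_on k S (\<lambda>x. f x + g x)"
  using assms(2,3)
proof (induction k arbitrary: f g)
  case (Suc k)
  show ?case
    by (rule Ck_on_SucI[OF assms(1) has_derivative_add[OF Ck_on_has_derivative[OF Suc.prems(1)]
            Ck_on_has_derivative[OF Suc.prems(2)]]])
      (assumption | intro Suc.IH Ck_on_frechet Suc.prems)+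
qed (simp add: continuous_on_add)

lemma Ck_on_mult:
  assumes "open S" "Ck_on k S f" "Ck_on k S g"
  shows "Ck_on k S (\<lambda>x. f x * g x)"
  using assms(2,3)
proof (induction k arbitrary: f g)
  case (Suc k)
  show ?case
    by (rule Ck_on_SucI[OF assms(1) has_derivative_mult[OF Ck_on_has_derivative[OF Suc.prems(1)]
            Ck_on_has_derivative[OF Suc.prems(2)]]])
      (assumption | intro Ck_on_add assms(1) Suc.IH Ck_on_frechet Suc.prems
        Ck_on_SucD[OF Suc.prems(1)] Ck_on_SucD[OF Suc.prems(2)])+
qed (simp add: continuous_on_mult)

lemma Ck_on_inverse:
  assumes "open S" "Ck_on k S f" "\<And>x. x \<in> S \<Longrightarrow> f x \<noteq> 0"
  shows "Ck_on k S (\<lambda>x. inverse (f x))"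
  using assms(2)
proof (induction k)
  case (Suc k)
  have inv: "Ck_on k S (\<lambda>x. inverse (f x))" by (rule Suc.IH[OF Ck_on_SucD[OF Suc.prems]])
  show ?case
  proof (rule Ck_on_SucI[OF assms(1)])
    fix x assume x: "x \<in> S"
    show "((\<lambda>x. inverse (f x)) has_derivative
        (\<lambda>v. - 1 * (inverse (f x) * frechet_derivative f (at x) v * inverse (f x)))) (at x)"
      using Deriv.has_derivative_inverse[OF assms(3)[OF x] Ck_on_has_derivative[OF Suc.prems x]] by simp
  next
    fix v
    show "Ck_on k S (\<lambda>x. - 1 * (inverse (f x) * frechet_derivative f (at x) v * inverse (f x)))"
      by (intro Ck_on_mult Ck_on_const assms(1) inv Ck_on_frechet Suc.prems)
  qed
qed (use assms(3) in \<open>simp add: continuous_on_inverse\<close>)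

lemma Ck_on_sum:
  assumes "open S" "finite I" "\<And>i. i \<in> I \<Longrightarrow> Ck_on k S (f i)"
  shows "Ck_on k S (\<lambda>x. \<Sum>i\<in>I. f i x)"
  using assms(2,3) by (induction I) (simp_all add: Ck_on_const Ck_on_add assms(1))

text \<open>By the chain rule, a directional derivative of the composite is a sum over the basis of
  products: a derivative of a component of \<open>g\<close> times a partial derivative of
  \<open>f\<close> composed with \<open>g\<close>. The latter is again of the original shape at one
  order less, so the induction runs over all \<open>f\<close> with \<open>g\<close> fixed.\<close>

lemma Ck_on_compose:
  assumes "open S" "open T" "g ` S \<subseteq> T" "Ck_on k T f" "\<And>i. Ck_on k S (\<lambda>x. g x \<bullet> i)"
  shows "Ck_on k S (\<lambda>x. f (g x))"
  using assms(4,5)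
proof (induction k arbitrary: f)
  case 0
  from 0(2) have "continuous_on S g"
    by (subst continuous_on_componentwise) simp
  with 0(1) assms(3) show ?case by (auto intro: continuous_on_compose2)
next
  case (Suc k)
  \<comment> \<open>\<open>Ck_on\<close> concerns real-valued functions only, so the derivative of
    \<open>g\<close> is assembled from those of its coordinates.\<close>
  define Dg where "Dg x v = (\<Sum>i\<in>Basis. frechet_derivative (\<lambda>x. g x \<bullet> i) (at x) v *\<^sub>R i)" for x v
  have Dg: "(g has_derivative Dg x) (at x)" if "x \<in> S" for x
    by (subst has_derivative_componentwise_within)
      (use Ck_on_has_derivative[OF Suc.prems(2) that] in \<open>simp add: Dg_def\<close>)
  show ?case
  proof (rule Ck_on_SucI[OF assms(1)])
    fix x assume x: "x \<in> S"
    with assms(3) have gx: "g x \<in> T" by blast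
    interpret bounded_linear "frechet_derivative f (at (g x))"
      using Ck_on_has_derivative[OF Suc.prems(1) gx] by (rule has_derivative_bounded_linear)
    have "((\<lambda>x. f (g x)) has_derivative (\<lambda>v. frechet_derivative f (at (g x)) (Dg x v))) (at x)"
      by (rule has_derivative_compose[OF Dg[OF x] Ck_on_has_derivative[OF Suc.prems(1) gx]])
    also have "(\<lambda>v. frechet_derivative f (at (g x)) (Dg x v)) =
      (\<lambda>v. \<Sum>i\<in>Basis. frechet_derivative (\<lambda>x. g x \<bullet> i) (at x) v * frechet_derivative f (at (g x)) i)"
      by (simp add: Dg_def sum scaleR)
    finally show "((\<lambda>x. f (g x)) has_derivative \<dots>) (at x)" .
  next
    fix v
    show "Ck_on k S (\<lambda>x. \<Sum>i\<in>Basis. frechet_derivative (\<lambda>x. g x \<bullet> i) (at x) v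
        * frechet_derivative f (at (g x)) i)"
    proof (intro Ck_on_sum Ck_on_mult assms(1) finite_Basis)
      fix i :: 'b
      show "Ck_on k S (\<lambda>x. frechet_derivative (\<lambda>x. g x \<bullet> i) (at x) v)"
        by (rule Ck_on_frechet[OF Suc.prems(2)])
      show "Ck_on k S (\<lambda>x. frechet_derivative f (at (g x)) i)"
        by (rule Suc.IH[OF Ck_on_frechet[OF Suc.prems(1)] Ck_on_SucD[OF Suc.prems(2)]])
    qed
  qed
qed

section \<open>Smooth dependence of integrals on parameters\<close>

text \<open>Differentiation under the integral sign gives the integral of the derivative of
  \<open>K\<close> in direction \<open>(v, 0)\<close>, which has the same form at one order less.
  Convexity of \<open>S\<close> serves the Leibniz rule.\<close>

lemma Ck_on_integral:
  fixes K :: "'a::euclidean_space \<times> real \<Rightarrow> real"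
  assumes "open S" "convex S" "Ck_on k (S \<times> UNIV) K"
  shows "Ck_on k S (\<lambda>y. integral {0..1} (\<lambda>\<tau>. K (y, \<tau>)))"
  using assms(3)
proof (induction k arbitrary: K)
  case 0
  then have "continuous_on (S \<times> cbox 0 1) (\<lambda>(y, \<tau>). K (y, \<tau>))"
    by (auto elim: continuous_on_subset)
  from integral_continuous_on_param[OF this] show ?case by simp
next
  case (Suc k)
  let ?D = "\<lambda>y \<tau>. frechet_derivative K (at (y, \<tau>))"
  \<comment> \<open>The Leibniz rule takes the parameter derivative as a continuous family of
    bounded linear maps; in finite dimension continuity can be tested on basis vectors.\<close>
  define B where "B y \<tau> = Blinfun (\<lambda>v. ?D y \<tau> (v, 0))" for y \<tau>
  have der: "(K has_derivative ?D y \<tau>) (at (y, \<tau>))" if "y \<in> S" for y \<tau>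
    using Ck_on_has_derivative[OF Suc.prems] that by simp
  have der1: "((\<lambda>y. K (y, \<tau>)) has_derivative (\<lambda>v. ?D y \<tau> (v, 0))) (at y)" if "y \<in> S" for y \<tau>
    by (rule has_derivative_compose[of "\<lambda>y. (y, \<tau>)", OF _ der[OF that]])
      (auto intro!: derivative_eq_intros)
  have B: "blinfun_apply (B y \<tau>) = (\<lambda>v. ?D y \<tau> (v, 0))" if "y \<in> S" for y \<tau>
    unfolding B_def by (rule bounded_linear_Blinfun_apply[OF has_derivative_bounded_linear[OF der1[OF that]]])
  have contB: "continuous_on (S \<times> cbox 0 1) (\<lambda>(y, \<tau>). B y \<tau>)"
  proof (rule continuous_on_blinfun_componentwise)
    fix i :: 'a
    have "continuous_on (S \<times> UNIV) (\<lambda>z. frechet_derivative K (at z) (i, 0))"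
      by (rule Ck_on_imp_continuous_on[OF Ck_on_frechet[OF Suc.prems]])
    then have "continuous_on (S \<times> cbox 0 1) (\<lambda>z. frechet_derivative K (at z) (i, 0))"
      by (rule continuous_on_subset) auto
    then show "continuous_on (S \<times> cbox 0 1) (\<lambda>z. blinfun_apply (case z of (y, \<tau>) \<Rightarrow> B y \<tau>) i)"
      by (rule continuous_on_eq) (auto simp: B)
  qed
  have slice: "(\<lambda>\<tau>. K (y, \<tau>)) integrable_on cbox 0 1" if "y \<in> S" for y
    by (rule integrable_continuous, rule continuous_on_compose2[OF Ck_on_imp_continuous_on[OF Suc.prems]])
      (auto intro!: continuous_intros simp: that)
  have sliceB: "B y integrable_on cbox 0 1" if "y \<in> S" for y
    by (rule integrable_continuous, rule continuous_on_compose2[OF contB, where f="\<lambda>\<tau>. (y, \<tau>)", simplified])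
      (auto intro!: continuous_intros simp: that)
  show ?case
  proof (rule Ck_on_SucI[OF assms(1)])
    fix y assume y: "y \<in> S"
    have "((\<lambda>y. integral (cbox 0 1) (\<lambda>\<tau>. K (y, \<tau>))) has_derivative integral (cbox 0 1) (B y)) (at y within S)"
      by (rule leibniz_rule[where fx=B])
        (use der1 B slice contB y assms(2) in \<open>auto intro: has_derivative_at_withinI\<close>)
    then have "((\<lambda>y. integral (cbox 0 1) (\<lambda>\<tau>. K (y, \<tau>))) has_derivative integral (cbox 0 1) (B y)) (at y)"
      by (simp only: at_within_open[OF y assms(1)])
    moreover have "blinfun_apply (integral (cbox 0 1) (B y)) = (\<lambda>v. integral {0..1} (\<lambda>\<tau>. ?D y \<tau> (v, 0)))"
      using blinfun_apply_integral[OF sliceB[OF y]] by (auto simp: B[OF y])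
    ultimately show "((\<lambda>y. integral {0..1} (\<lambda>\<tau>. K (y, \<tau>))) has_derivative
        (\<lambda>v. integral {0..1} (\<lambda>\<tau>. ?D y \<tau> (v, 0)))) (at y)"
      by simp
  next
    fix v
    show "Ck_on k S (\<lambda>y. integral {0..1} (\<lambda>\<tau>. ?D y \<tau> (v, 0)))"
      by (rule Suc.IH[OF Ck_on_frechet[OF Suc.prems]])
  qed
qed

section \<open>Equality of mixed partial derivatives\<close>

text \<open>Write an increment of \<open>g\<close> in its second argument as an integral of
  \<open>gr\<close>, differentiate under the integral in \<open>s\<close>, then recover the
  integrand \<open>grs\<close> by differentiating in the upper limit.\<close>

lemma mixed_partials_eq:
  fixes g :: "real \<Rightarrow> real \<Rightarrow> real"
  assumes gs: "\<And>s r. ((\<lambda>s. g s r) has_real_derivative gs s r) (at s)"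
    and gr: "\<And>s r. ((\<lambda>r. g s r) has_real_derivative gr s r) (at r)"
    and gsr: "\<And>s r. ((\<lambda>r. gs s r) has_real_derivative gsr s r) (at r)"
    and grs: "\<And>s r. ((\<lambda>s. gr s r) has_real_derivative grs s r) (at s)"
    and cont: "continuous_on UNIV (\<lambda>(s, r). grs s r)"
    and cont': "\<And>s. continuous_on UNIV (gr s)"
  shows "gsr s r = grs s r"
proof -
  \<comment> \<open>The base point \<open>r - 1\<close> lies strictly left of \<open>r\<close>, so
    the identity holds in a neighbourhood of \<open>r\<close> and yields a two-sided derivative
    there.\<close>
  have eq: "gs s y - gs s (r - 1) = integral {r - 1..y} (grs s)" if "y \<ge> r - 1" for y
  proof -
    have "((\<lambda>s. integral (cbox (r - 1) y) (gr s)) has_real_derivative integral (cbox (r - 1) y) (grs s))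
        (at s within UNIV)"
    proof (rule leibniz_rule_field_derivative)
      show "continuous_on (UNIV \<times> cbox (r - 1) y) (\<lambda>(x, t). grs x t)"
        by (rule continuous_on_subset[OF cont]) simp
      show "gr x integrable_on cbox (r - 1) y" for x
        by (rule integrable_continuous, rule continuous_on_subset[OF cont']) simp
    qed (use grs in auto)
    moreover have "integral {r - 1..y} (gr x) = g x y - g x (r - 1)" for x
      by (rule integral_unique, rule fundamental_theorem_of_calculus[OF that])
        (use gr[of x] in \<open>auto simp: has_real_derivative_iff_has_vector_derivative
          intro: has_vector_derivative_at_within\<close>)
    ultimately have "((\<lambda>x. g x y - g x (r - 1)) has_real_derivative integral {r - 1..y} (grs s)) (at s)"
      by simp
    moreover have "((\<lambda>x. g x y - g x (r - 1)) has_real_derivative gs s y - gs s (r - 1)) (at s)"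
      by (intro DERIV_diff gs)
    ultimately show ?thesis by (rule DERIV_unique[symmetric])
  qed
  have c: "continuous_on {r - 1..r + 1} (grs s)"
    by (rule continuous_on_compose2[OF cont, where f="\<lambda>r. (s, r)", simplified])
      (auto intro!: continuous_intros)
  have "((\<lambda>y. integral {r - 1..y} (grs s)) has_real_derivative grs s r) (at r within {r - 1..r + 1})"
    by (rule integral_has_real_derivative[OF c]) simp
  then have "((\<lambda>y. integral {r - 1..y} (grs s)) has_real_derivative grs s r) (at r)"
    by (simp add: at_within_Icc_at)
  then have "((\<lambda>y. gs s y - gs s (r - 1)) has_real_derivative grs s r) (at r)"
    by (rule has_field_derivative_transform_within_open[where S="{r - 1<..}"]) (simp_all add: eq)
  moreover have "((\<lambda>y. gs s y - gs s (r - 1)) has_real_derivative gsr s r) (at r)"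
    using DERIV_diff[OF gsr DERIV_const] by simp
  ultimately show ?thesis by (rule DERIV_unique[symmetric])
qed

section \<open>Smooth functions, smooth maps and their partial derivatives\<close>

text \<open>Testing against every vector \<open>i\<close> rather than basis vectors only makes
  pairing immediate, since the inner product on a product space splits into a sum.\<close>

definition smooth_map_on :: "'a::euclidean_space set \<Rightarrow> ('a \<Rightarrow> 'b::euclidean_space) \<Rightarrow> bool" where
  "smooth_map_on S g \<longleftrightarrow> (\<forall>i. smooth_on S (\<lambda>x. g x \<bullet> i))"

lemma smooth_on_const: "open S \<Longrightarrow> smooth_on S (\<lambda>x. c)"
  by (simp add: smooth_on_def Ck_on_const)

lemma smooth_on_bounded_linear: "open S \<Longrightarrow> bounded_linear f \<Longrightarrow> smooth_on S f"
  by (simp add: smooth_on_def Ck_on_bounded_linear)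

lemma smooth_on_add: "open S \<Longrightarrow> smooth_on S f \<Longrightarrow> smooth_on S g \<Longrightarrow> smooth_on S (\<lambda>x. f x + g x)"
  by (simp add: smooth_on_def Ck_on_add)

lemma smooth_on_mult: "open S \<Longrightarrow> smooth_on S f \<Longrightarrow> smooth_on S g \<Longrightarrow> smooth_on S (\<lambda>x. f x * g x)"
  by (simp add: smooth_on_def Ck_on_mult)

lemma smooth_on_diff:
  assumes "open S" "smooth_on S f" "smooth_on S g"
  shows "smooth_on S (\<lambda>x. f x - g x)"
  using smooth_on_add[OF assms(1,2) smooth_on_mult[OF assms(1) smooth_on_const[OF assms(1), of "-1"] assms(3)]]
  by simp

lemma smooth_on_divide:
  assumes "open S" "smooth_on S f" "smooth_on S g" "\<And>x. x \<in> S \<Longrightarrow> g x \<noteq> 0"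
  shows "smooth_on S (\<lambda>x. f x / g x)"
  using smooth_on_mult[OF assms(1,2), of "\<lambda>x. inverse (g x)"] Ck_on_inverse[OF assms(1) _ assms(4)] assms(3)
  by (simp add: smooth_on_def divide_inverse)

lemma smooth_map_on_Pair:
  assumes "open S" "smooth_map_on S f" "smooth_map_on S g"
  shows "smooth_map_on S (\<lambda>x. (f x, g x))"
  using assms by (auto simp: smooth_map_on_def inner_Pair smooth_on_add)

lemma smooth_map_on_real:
  fixes f :: "'a::euclidean_space \<Rightarrow> real"
  assumes "open S" "smooth_on S f"
  shows "smooth_map_on S f"
  using assms by (auto simp: smooth_map_on_def smooth_on_mult smooth_on_const)

lemma smooth_on_compose:
  assumes "open S" "open T" "smooth_on T f" "smooth_map_on S g" "\<And>x. x \<in> S \<Longrightarrow> g x \<in> T"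
  shows "smooth_on S (\<lambda>x. f (g x))"
proof -
  have "g ` S \<subseteq> T" using assms(5) by blast
  with assms show ?thesis by (auto simp: smooth_on_def smooth_map_on_def intro: Ck_on_compose)
qed

lemma smooth_on_imp_continuous_on: "smooth_on S f \<Longrightarrow> continuous_on S f"
  unfolding smooth_on_def using Ck_on_imp_continuous_on by blast

lemma smooth_on_has_derivative:
  "smooth_on S f \<Longrightarrow> x \<in> S \<Longrightarrow> (f has_derivative frechet_derivative f (at x)) (at x)"
  unfolding smooth_on_def using Ck_on_has_derivative by blast

lemma smooth_on_frechet: "smooth_on S f \<Longrightarrow> smooth_on S (\<lambda>x. frechet_derivative f (at x) v)"
  unfolding smooth_on_def using Ck_on_frechet by blast

text \<open>The chain rule along a curve; with coordinate lines as curves it identifies one-variable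
  partial derivatives with values of the Frechet derivative.\<close>

lemma smooth_on_curve:
  assumes "smooth_on S f" "\<gamma> s \<in> S" "(\<gamma> has_vector_derivative \<gamma>') (at s)"
  shows "((\<lambda>s. f (\<gamma> s)) has_real_derivative frechet_derivative f (at (\<gamma> s)) \<gamma>') (at s)"
proof -
  interpret bounded_linear "frechet_derivative f (at (\<gamma> s))"
    using smooth_on_has_derivative[OF assms(1,2)] by (rule has_derivative_bounded_linear)
  show ?thesis
    using has_derivative_compose[OF assms(3)[unfolded has_vector_derivative_def]
        smooth_on_has_derivative[OF assms(1,2)]]
    by (simp add: has_field_derivative_def scaleR mult.commute[of _ "frechet_derivative f (at (\<gamma> s)) \<gamma>'"])
qed

lemma smooth_on_integral:
  fixes K :: "'a::euclidean_space \<times> real \<Rightarrow> real"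
  assumes "open S" "convex S" "smooth_on (S \<times> UNIV) K"
  shows "smooth_on S (\<lambda>y. integral {0..1} (\<lambda>\<tau>. K (y, \<tau>)))"
  using assms Ck_on_integral by (auto simp: smooth_on_def)

lemma smooth_on_mixed_partials:
  fixes G :: "real \<times> real \<Rightarrow> real"
  assumes "smooth_on UNIV G"
  defines "D1 \<equiv> \<lambda>z. frechet_derivative G (at z) (1, 0)"
    and "D2 \<equiv> \<lambda>z. frechet_derivative G (at z) (0, 1)"
  shows "((\<lambda>s. G (s, r)) has_real_derivative D1 (s, r)) (at s)"
    and "((\<lambda>r. G (s, r)) has_real_derivative D2 (s, r)) (at r)"
    and "\<exists>m. ((\<lambda>r. D1 (s, r)) has_real_derivative m) (at r) \<and>
             ((\<lambda>s. D2 (s, r)) has_real_derivative m) (at s)"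
proof -
  have p1: "((\<lambda>s. H (s, r)) has_real_derivative frechet_derivative H (at (s, r)) (1, 0)) (at s)"
    if "smooth_on UNIV H" for H :: "real \<times> real \<Rightarrow> real" and s r
    by (rule smooth_on_curve[OF that]) (auto intro!: derivative_eq_intros)
  have p2: "((\<lambda>r. H (s, r)) has_real_derivative frechet_derivative H (at (s, r)) (0, 1)) (at r)"
    if "smooth_on UNIV H" for H :: "real \<times> real \<Rightarrow> real" and s r
    by (rule smooth_on_curve[OF that]) (auto intro!: derivative_eq_intros)
  have s1: "smooth_on UNIV D1" and s2: "smooth_on UNIV D2"
    unfolding D1_def D2_def by (intro smooth_on_frechet assms(1))+
  show d1: "((\<lambda>s. G (s, r)) has_real_derivative D1 (s, r)) (at s)" for s r
    unfolding D1_def by (rule p1[OF assms(1)])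
  show d2: "((\<lambda>r. G (s, r)) has_real_derivative D2 (s, r)) (at r)" for s r
    unfolding D2_def by (rule p2[OF assms(1)])
  have "frechet_derivative D1 (at (s, r)) (0, 1) = frechet_derivative D2 (at (s, r)) (1, 0)"
    by (rule mixed_partials_eq[OF d1 d2 p2[OF s1] p1[OF s2]])
      (use smooth_on_imp_continuous_on[OF smooth_on_frechet[OF s2, of "(1, 0)"]] in
        \<open>auto intro!: continuous_on_compose2[OF smooth_on_imp_continuous_on[OF s2]] continuous_intros\<close>)
  with p2[OF s1, of s r] p1[OF s2, of r s]
  show "\<exists>m. ((\<lambda>r. D1 (s, r)) has_real_derivative m) (at r) \<and>
             ((\<lambda>s. D2 (s, r)) has_real_derivative m) (at s)" by auto
qed

lemma antiderivative_UNIV: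
  fixes f :: "real \<Rightarrow> real"
  assumes "continuous_on UNIV f"
  obtains g where "\<And>x. (g has_real_derivative f x) (at x)"
  using einterval_antiderivative[of "-\<infinity>" "\<infinity>" f] assms
  by (auto simp: continuous_on_eq_continuous_at has_real_derivative_iff_has_vector_derivative)

text \<open>After the substitution \<open>s = \<tau> * b\<close> this is the integral of
  \<open>f\<close> from 0 to \<open>b\<close>. Rescaling to the fixed interval from 0 to 1 covers
  negative \<open>b\<close> as well and matches the form of
  \<open>smooth_on_integral\<close>.\<close>

lemma has_real_derivative_scaled_integral:
  fixes f :: "real \<Rightarrow> real"
  assumes "continuous_on UNIV f"
  shows "((\<lambda>b. integral {0..1} (\<lambda>\<tau>. b * f (\<tau> * b))) has_real_derivative f b) (at b)"
proof -
  obtain g where g: "\<And>x. (g has_real_derivative f x) (at x)"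
    using antiderivative_UNIV[OF assms] by blast
  have "((\<lambda>\<tau>. g (\<tau> * b)) has_real_derivative b * f (\<tau> * b)) (at \<tau> within A)" for b \<tau> A
    by (rule DERIV_cong[OF DERIV_chain2[OF g, where Db=b]]) (auto intro!: derivative_eq_intros)
  then have "integral {0..1} (\<lambda>\<tau>. b * f (\<tau> * b)) = g (1 * b) - g (0 * b)" for b
    by (intro integral_unique fundamental_theorem_of_calculus)
      (auto simp flip: has_real_derivative_iff_has_vector_derivative)
  moreover have "((\<lambda>b. g (1 * b) - g (0 * b)) has_real_derivative f b) (at b)"
    using DERIV_diff[OF g DERIV_const] by simp
  ultimately show ?thesis by simp
qed

subsection \<open>Discrete operators as functions of the grid values\<close>

lemma open_dom_L: "open dom_L"
  unfolding dom_L_def case_prod_unfold by (intro open_Collect_less continuous_intros)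

lemma convex_dom_L: "convex dom_L"
proof -
  have "dom_L = UNIV \<times> UNIV \<times> UNIV \<times> {0<..}" by (auto simp: dom_L_def)
  moreover have "convex (UNIV \<times> UNIV \<times> UNIV \<times> {0<..} :: (real \<times> real \<times> real \<times> real) set)"
    by (intro convex_Times convex_UNIV convex_real_interval)
  ultimately show ?thesis by simp
qed

lemma open_dom_P: "open dom_P"
  unfolding dom_P_def case_prod_unfold by (intro open_Collect_less continuous_intros)

text \<open>The partial derivatives are defined by \<open>deriv\<close> along coordinate lines;
  smoothness turns them into values of one Frechet derivative, and its linearity gives the
  formula.\<close>

lemma dL_chain:
  assumes "smooth_on dom_L L" "h > 0"
    and x: "(x has_real_derivative x') (at s)" and v: "(v has_real_derivative v') (at s)"
  shows "((\<lambda>s. L (x s, v s, t, h)) has_real_derivative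
    dL_dx L (x s, v s, t, h) * x' + dL_dv L (x s, v s, t, h) * v') (at s)"
proof -
  have dom: "(a, b, t, h) \<in> dom_L" for a b using assms(2) by (simp add: dom_L_def)
  let ?D = "frechet_derivative L (at (x s, v s, t, h))"
  interpret bounded_linear ?D
    using smooth_on_has_derivative[OF assms(1) dom] by (rule has_derivative_bounded_linear)
  \<comment> \<open>Stated for arbitrary \<open>x\<close> and \<open>v\<close> because it is used
    three times: for the two coordinate lines and for the given curve.\<close>
  have vd: "((\<lambda>s. (x s, v s, t, h)) has_vector_derivative (x', v', 0, 0)) (at s)"
    if "(x has_real_derivative x') (at s)" "(v has_real_derivative v') (at s)" for x v x' v' s
    using that unfolding has_real_derivative_iff_has_vector_derivative
    by (intro has_vector_derivative_Pair has_vector_derivative_const) (auto simp flip: zero_prod_def)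
  have "dL_dx L (x s, v s, t, h) = ?D (1, 0, 0, 0)"
    unfolding dL_dx_def prod.case
    by (rule DERIV_imp_deriv, rule smooth_on_curve[where \<gamma>="\<lambda>y. (y, v s, t, h)", OF assms(1) dom vd])
      (auto intro!: derivative_eq_intros)
  moreover have "dL_dv L (x s, v s, t, h) = ?D (0, 1, 0, 0)"
    unfolding dL_dv_def prod.case
    by (rule DERIV_imp_deriv, rule smooth_on_curve[where \<gamma>="\<lambda>y. (x s, y, t, h)", OF assms(1) dom vd])
      (auto intro!: derivative_eq_intros)
  moreover have "?D (x', v', 0, 0) = ?D (1, 0, 0, 0) * x' + ?D (0, 1, 0, 0) * v'"
    using add[of "x' *\<^sub>R (1, 0, 0, 0)" "v' *\<^sub>R (0, 1, 0, 0)"]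
    by (simp add: scaleR[of x' "(1, 0, 0, 0)"] scaleR[of v' "(0, 1, 0, 0)"] del: scaleR_Pair) simp
  ultimately show ?thesis using smooth_on_curve[OF assms(1) dom vd[OF x v]] by simp
qed

lemma dP_chain:
  assumes "smooth_on dom_P P" "h > 0"
    and vm: "(vm has_real_derivative vm') (at s)" and vp: "(vp has_real_derivative vp') (at s)"
    and w: "(w has_real_derivative w') (at s)"
  shows "((\<lambda>s. P (x, vm s, vp s, w s, t, h)) has_real_derivative
    dP_dvm P (x, vm s, vp s, w s, t, h) * vm' + dP_dvp P (x, vm s, vp s, w s, t, h) * vp'
    + dP_dw P (x, vm s, vp s, w s, t, h) * w') (at s)"
proof -
  have dom: "(x, a, b, c, t, h) \<in> dom_P" for a b c using assms(2) by (simp add: dom_P_def)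
  let ?D = "frechet_derivative P (at (x, vm s, vp s, w s, t, h))"
  interpret bounded_linear ?D
    using smooth_on_has_derivative[OF assms(1) dom] by (rule has_derivative_bounded_linear)
  have vd: "((\<lambda>s. (x, vm s, vp s, w s, t, h)) has_vector_derivative (0, vm', vp', w', 0, 0)) (at s)"
    if "(vm has_real_derivative vm') (at s)" "(vp has_real_derivative vp') (at s)"
      "(w has_real_derivative w') (at s)" for vm vp w vm' vp' w' s
    using that unfolding has_real_derivative_iff_has_vector_derivative
    by (intro has_vector_derivative_Pair has_vector_derivative_const) (auto simp flip: zero_prod_def)
  have "dP_dvm P (x, vm s, vp s, w s, t, h) = ?D (0, 1, 0, 0, 0, 0)"
    unfolding dP_dvm_def prod.case
    by (rule DERIV_imp_deriv, rule smooth_on_curve[where \<gamma>="\<lambda>y. (x, y, vp s, w s, t, h)", OF assms(1) dom vd]) (auto intro!: derivative_eq_intros)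
  moreover have "dP_dvp P (x, vm s, vp s, w s, t, h) = ?D (0, 0, 1, 0, 0, 0)"
    unfolding dP_dvp_def prod.case
    by (rule DERIV_imp_deriv, rule smooth_on_curve[where \<gamma>="\<lambda>y. (x, vm s, y, w s, t, h)", OF assms(1) dom vd]) (auto intro!: derivative_eq_intros)
  moreover have "dP_dw P (x, vm s, vp s, w s, t, h) = ?D (0, 0, 0, 1, 0, 0)"
    unfolding dP_dw_def prod.case
    by (rule DERIV_imp_deriv, rule smooth_on_curve[where \<gamma>="\<lambda>y. (x, vm s, vp s, y, t, h)", OF assms(1) dom vd]) (auto intro!: derivative_eq_intros)
  moreover have "?D (0, vm', vp', w', 0, 0) = ?D (0, 1, 0, 0, 0, 0) * vm' + ?D (0, 0, 1, 0, 0, 0) * vp'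
      + ?D (0, 0, 0, 1, 0, 0) * w'"
  proof -
    have "(0, vm', vp', w', 0, 0) = vm' *\<^sub>R (0, 1, 0, 0, 0, 0) + vp' *\<^sub>R (0, 0, 1, 0, 0, 0)
        + w' *\<^sub>R (0::real, 0::real, 0::real, 1::real, 0::real, 0::real)" by simp
    then have "?D (0, vm', vp', w', 0, 0) = ?D (vm' *\<^sub>R (0, 1, 0, 0, 0, 0) + vp' *\<^sub>R (0, 0, 1, 0, 0, 0)
        + w' *\<^sub>R (0, 0, 0, 1, 0, 0))" by (rule arg_cong)
    also have "\<dots> = vm' *\<^sub>R ?D (0, 1, 0, 0, 0, 0) + vp' *\<^sub>R ?D (0, 0, 1, 0, 0, 0)
        + w' *\<^sub>R ?D (0, 0, 0, 1, 0, 0)" by (simp only: add scaleR)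
    finally show ?thesis by (simp add: mult.commute)
  qed
  ultimately show ?thesis using smooth_on_curve[OF assms(1) dom vd[OF vm vp w]] by simp
qed

section \<open>Reduction from grids to free real variables\<close>

text \<open>The arguments \<open>a\<close>, \<open>b\<close>, \<open>c\<close> stand for three
  consecutive grid values; the fourth entry is the second difference, kept as a difference of the
  two slopes.\<close>

definition stencil ::
  "real \<Rightarrow> real \<Rightarrow> real \<Rightarrow> real \<Rightarrow> real \<Rightarrow> real \<times> real \<times> real \<times> real \<times> real \<times> real" where
  "stencil a b c t h = (b, (b - a) / h, (c - b) / h, ((c - b) / h - (b - a) / h) / h, t, h)"

text \<open>The contribution of one grid step to the discrete action: \<open>L\<^sub>-\<close> is attached to the right
  endpoint of the step and \<open>L\<^sub>+\<close> to the left one.\<close>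

definition step_Lagrangian ::
  "(real \<times> real \<times> real \<times> real \<Rightarrow> real) \<Rightarrow> (real \<times> real \<times> real \<times> real \<Rightarrow> real)
    \<Rightarrow> real \<Rightarrow> real \<Rightarrow> real \<Rightarrow> real \<Rightarrow> real" where
  "step_Lagrangian Lm Lp b c t h = Lp (b, (c - b) / h, t, h) + Lm (c, (c - b) / h, t + h, h)"

lemma star_eq_stencil: "p \<ge> 1 \<Longrightarrow> star h t Q p = stencil (Q (p - 1)) (Q p) (Q (p + 1)) (t p) h"
  by (simp add: star_def stencil_def Delta_minus_def Delta_plus_def minus_divide_left)

lemma uniform_grid_Suc: "uniform_grid N h t \<Longrightarrow> i < N \<Longrightarrow> t (Suc i) = t i + h"
  by (auto simp: uniform_grid_def algebra_simps)

lemma uniform_grid_arith: "h > 0 \<Longrightarrow> uniform_grid 4 h (\<lambda>i. t0 + real i * h)"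
  by (simp add: uniform_grid_def algebra_simps)

text \<open>Any three reals occur as consecutive entries of some sequence, and any time and positive
  step size occur on an arithmetic grid, so a local condition on all grids is a condition on free
  variables.\<close>

lemma all_grids_iff3:
  fixes \<Phi> :: "real \<Rightarrow> real \<Rightarrow> real \<Rightarrow> real \<Rightarrow> real \<Rightarrow> bool"
  shows
  "(\<forall>N h t Q. uniform_grid N h t \<longrightarrow> (\<forall>p\<in>{1..N - 1}. \<Phi> (Q (p - 1)) (Q p) (Q (p + 1)) (t p) h))
    \<longleftrightarrow> (\<forall>a b c t h. h > 0 \<longrightarrow> \<Phi> a b c t h)" (is "?L \<longleftrightarrow> ?R")
proof
  assume L: ?L
  show ?R
  proof (intro allI impI)
    fix a b c t h :: real assume "h > 0"
    \<comment> \<open>Starting the grid at \<open>t - h\<close> makes \<open>t\<close> the time at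
      index 1, where the neighbours have indices 0 and 2.\<close>
    from L[rule_format, OF uniform_grid_arith[OF this], of 1 "(!) [a, b, c]" "t - h"]
    show "\<Phi> a b c t h" by simp
  qed
qed (auto simp: uniform_grid_def)

lemma all_grids_iff4:
  fixes \<Phi> :: "real \<Rightarrow> real \<Rightarrow> real \<Rightarrow> real \<Rightarrow> real \<Rightarrow> real \<Rightarrow> bool"
  shows
  "(\<forall>N h t Q. uniform_grid N h t \<longrightarrow>
      (\<forall>p\<in>{2..N - 1}. \<Phi> (Q (p - 2)) (Q (p - 1)) (Q p) (Q (p + 1)) (t (p - 1)) h))
    \<longleftrightarrow> (\<forall>a b c d t h. h > 0 \<longrightarrow> \<Phi> a b c d t h)" (is "?L \<longleftrightarrow> ?R")
proof
  assume L: ?L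
  show ?R
  proof (intro allI impI)
    fix a b c d t h :: real assume "h > 0"
    \<comment> \<open>Here \<open>p\<close> is 2 and the time is read at \<open>p - 1\<close>, so
      the grid again starts at \<open>t - h\<close>.\<close>
    from L[rule_format, OF uniform_grid_arith[OF this], of 2 "(!) [a, b, c, d]" "t - h"]
    show "\<Phi> a b c d t h" by (simp add: numeral_2_eq_2 numeral_3_eq_3)
  qed
qed (auto simp: uniform_grid_def)

text \<open>The left value \<open>a\<close> enters the backward slope with factor
  \<open>- 1 / h\<close> and the second difference with factor \<open>1 / h\<^sup>2\<close>.\<close>

lemma deriv_stencil_left:
  assumes "smooth_on dom_P P" "h > 0"
  shows "deriv (\<lambda>x. P (stencil x b c t h)) a =
    dP_dw P (stencil a b c t h) / h\<^sup>2 - dP_dvm P (stencil a b c t h) / h"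
  unfolding stencil_def
  by (rule DERIV_imp_deriv,
      rule DERIV_cong[OF dP_chain[OF assms, where vm'="- 1 / h" and vp'=0 and w'="1 / h\<^sup>2"]])
    (use assms(2) in \<open>auto intro!: derivative_eq_intros simp: power2_eq_square\<close>)

lemma deriv_stencil_right:
  assumes "smooth_on dom_P P" "h > 0"
  shows "deriv (\<lambda>x. P (stencil a b x t h)) c =
    dP_dw P (stencil a b c t h) / h\<^sup>2 + dP_dvp P (stencil a b c t h) / h"
  unfolding stencil_def
  by (rule DERIV_imp_deriv,
      rule DERIV_cong[OF dP_chain[OF assms, where vm'=0 and vp'="1 / h" and w'="1 / h\<^sup>2"]])
    (use assms(2) in \<open>auto intro!: derivative_eq_intros simp: power2_eq_square\<close>)

text \<open>Subtract the right-value derivative at \<open>p - 1\<close> from the left-value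
  derivative at \<open>p\<close>. The \<open>w\<close> terms form a backward difference over
  \<open>h\<close>, the slope terms a sum over \<open>h\<close>; multiplying by \<open>h\<close>
  leaves the Helmholtz condition.\<close>

lemma Helmholtz_iff:
  assumes "smooth_on dom_P P"
  shows "(\<forall>N h t Q. uniform_grid N h t \<longrightarrow>
        (\<forall>p\<in>{2..N - 1}.
           Delta_minus h (\<lambda>q. dP_dw P (star h t Q q)) p =
             dP_dvm P (star h t Q p) + dP_dvp P (star h t Q (p - 1))))
    \<longleftrightarrow> (\<forall>a b c d t h. h > 0 \<longrightarrow>
      deriv (\<lambda>x. P (stencil x c d (t + h) h)) b = deriv (\<lambda>x. P (stencil a b x t h)) c)"
    (is "_ \<longleftrightarrow> (\<forall>a b c d t h. h > 0 \<longrightarrow> ?\<Phi> a b c d t h)")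
proof -
  have "(Delta_minus h (\<lambda>q. dP_dw P (star h t Q q)) p =
             dP_dvm P (star h t Q p) + dP_dvp P (star h t Q (p - 1)))
      \<longleftrightarrow> ?\<Phi> (Q (p - 2)) (Q (p - 1)) (Q p) (Q (p + 1)) (t (p - 1)) h"
    if g: "uniform_grid N h t" and p: "p \<in> {2..N - 1}" for N h t Q p
  proof -
    \<comment> \<open>With \<open>p\<close> at least 2, the truncated subtractions
      \<open>p - 1\<close> and \<open>p - 2\<close> are genuine.\<close>
    obtain j where j: "p = Suc (Suc j)" using p by (metis atLeastAtMost_iff add_2_eq_Suc le_Suc_ex)
    have h: "h > 0" and N: "N \<ge> 4" using g by (auto simp: uniform_grid_def)
    have t: "t p = t (p - 1) + h" using uniform_grid_Suc[OF g, of "Suc j"] p j N by simp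
    have e1: "star h t Q p = stencil (Q (p - 1)) (Q p) (Q (p + 1)) (t (p - 1) + h) h"
      using star_eq_stencil[of p h t Q] p t by simp
    have e2: "star h t Q (p - 1) = stencil (Q (p - 2)) (Q (p - 1)) (Q p) (t (p - 1)) h"
      using star_eq_stencil[of "p - 1" h t Q] j by simp
    show ?thesis
      unfolding Delta_minus_def e1 e2 deriv_stencil_left[OF assms h] deriv_stencil_right[OF assms h]
      using h by (simp add: field_simps power2_eq_square)
  qed
  then have "(\<forall>N h t Q. uniform_grid N h t \<longrightarrow>
        (\<forall>p\<in>{2..N - 1}.
           Delta_minus h (\<lambda>q. dP_dw P (star h t Q q)) p =
             dP_dvm P (star h t Q p) + dP_dvp P (star h t Q (p - 1))))
    \<longleftrightarrow> (\<forall>N h t Q. uniform_grid N h t \<longrightarrow>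
      (\<forall>p\<in>{2..N - 1}. ?\<Phi> (Q (p - 2)) (Q (p - 1)) (Q p) (Q (p + 1)) (t (p - 1)) h))"
    by (intro all_cong1 imp_cong refl ball_cong) blast
  also note all_grids_iff4
  finally show ?thesis .
qed

lemma step_Lagrangian_derivs:
  assumes "smooth_on dom_L Lm" "smooth_on dom_L Lp" "h > 0"
  shows "deriv (\<lambda>x. step_Lagrangian Lm Lp x c t h) b =
      dL_dx Lp (b, (c - b) / h, t, h) - dL_dv Lp (b, (c - b) / h, t, h) / h
      - dL_dv Lm (c, (c - b) / h, t + h, h) / h"
    and "deriv (\<lambda>x. step_Lagrangian Lm Lp b x t h) c =
      dL_dv Lp (b, (c - b) / h, t, h) / h + dL_dx Lm (c, (c - b) / h, t + h, h)
      + dL_dv Lm (c, (c - b) / h, t + h, h) / h"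
proof -
  have b: "((\<lambda>x. (c - x) / h) has_real_derivative - 1 / h) (at b)"
    and c: "((\<lambda>x. (x - b) / h) has_real_derivative 1 / h) (at c)"
    using assms(3) by (auto intro!: derivative_eq_intros)
  show "deriv (\<lambda>x. step_Lagrangian Lm Lp x c t h) b =
      dL_dx Lp (b, (c - b) / h, t, h) - dL_dv Lp (b, (c - b) / h, t, h) / h
      - dL_dv Lm (c, (c - b) / h, t + h, h) / h"
    unfolding step_Lagrangian_def
    by (rule DERIV_imp_deriv, rule DERIV_cong[OF DERIV_add[OF
          dL_chain[OF assms(2,3) DERIV_ident b] dL_chain[OF assms(1,3) DERIV_const b]]]) simp
  show "deriv (\<lambda>x. step_Lagrangian Lm Lp b x t h) c =
      dL_dv Lp (b, (c - b) / h, t, h) / h + dL_dx Lm (c, (c - b) / h, t + h, h)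
      + dL_dv Lm (c, (c - b) / h, t + h, h) / h"
    unfolding step_Lagrangian_def
    by (rule DERIV_imp_deriv, rule DERIV_cong[OF DERIV_add[OF
          dL_chain[OF assms(2,3) DERIV_const c] dL_chain[OF assms(1,3) DERIV_ident c]]]) simp
qed

text \<open>Only the two grid steps adjacent to \<open>p\<close> involve \<open>Q p\<close>. The
  right-hand side is the derivative of their contributions: \<open>Q p\<close> is the left endpoint
  of the step starting at \<open>t\<close> and the right endpoint of the one starting at
  \<open>t - h\<close>.\<close>

lemma Euler_Lagrange_iff:
  assumes "smooth_on dom_L Lm" "smooth_on dom_L Lp"
  shows "(\<forall>N h t Q. uniform_grid N h t \<longrightarrow>
          (\<forall>p\<in>{1..N - 1}.
             fd_operator P h t Q p =
               dL_dx Lm (ast h t Q p) + dL_dx Lp (astast h t Q p)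
               + Delta_plus h (\<lambda>q. dL_dv Lm (ast h t Q q)) p
               - Delta_minus h (\<lambda>q. dL_dv Lp (astast h t Q q)) p))
    \<longleftrightarrow> (\<forall>a b c t h. h > 0 \<longrightarrow>
      P (stencil a b c t h) = deriv (\<lambda>x. step_Lagrangian Lm Lp x c t h) b
        + deriv (\<lambda>x. step_Lagrangian Lm Lp a x (t - h) h) b)"
    (is "?lhs \<longleftrightarrow> (\<forall>a b c t h. h > 0 \<longrightarrow> ?\<Phi> a b c t h)")
proof -
  have "(fd_operator P h t Q p =
               dL_dx Lm (ast h t Q p) + dL_dx Lp (astast h t Q p)
               + Delta_plus h (\<lambda>q. dL_dv Lm (ast h t Q q)) p
               - Delta_minus h (\<lambda>q. dL_dv Lp (astast h t Q q)) p)
      \<longleftrightarrow> ?\<Phi> (Q (p - 1)) (Q p) (Q (p + 1)) (t p) h"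
    if g: "uniform_grid N h t" and p: "p \<in> {1..N - 1}" for N h t Q p
  proof -
    obtain j where j: "p = Suc j" using p by (cases p) auto
    have h: "h > 0" and N: "N \<ge> 4" using g by (auto simp: uniform_grid_def)
    \<comment> \<open>The second equation is for \<open>Lm\<close> at the right endpoint
      \<open>p + 1\<close> of the following step; \<open>p \<le> N - 1\<close> keeps that index on
      the grid.\<close>
    have t: "t (Suc j) = t j + h" "t (Suc (Suc j)) = t j + h + h"
      using uniform_grid_Suc[OF g, of j] uniform_grid_Suc[OF g, of "Suc j"] p j N by auto
    show ?thesis
      unfolding fd_operator_def step_Lagrangian_derivs[OF assms h] star_eq_stencil[of p] j
      by (simp add: star_eq_stencil ast_def astast_def Delta_minus_def Delta_plus_def t minus_divide_left
          diff_divide_distrib) (rule iffI; linarith)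
  qed
  then have "?lhs \<longleftrightarrow> (\<forall>N h t Q. uniform_grid N h t \<longrightarrow>
      (\<forall>p\<in>{1..N - 1}. ?\<Phi> (Q (p - 1)) (Q p) (Q (p + 1)) (t p) h))"
    by (intro all_cong1 imp_cong refl ball_cong) blast
  also note all_grids_iff3
  finally show ?thesis .
qed

section \<open>From Lagrangians to the Helmholtz condition\<close>

text \<open>In \<open>F x c d (t + h)\<close> only the summand of the step from \<open>x\<close> to
  \<open>c\<close> at time \<open>t\<close> varies with \<open>x\<close>; in
  \<open>F a b x t\<close> only that of the step from \<open>b\<close> to \<open>x\<close> does.
  Both derivatives are thus mixed partials of the same step contribution at
  \<open>(b, c)\<close>.\<close>

lemma Euler_Lagrange_imp_Helmholtz:
  assumes smooth: "smooth_on dom_L Lm" "smooth_on dom_L Lp" and "h > 0"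
    and EL: "\<And>a b c t. F a b c t = deriv (\<lambda>x. step_Lagrangian Lm Lp x c t h) b
        + deriv (\<lambda>x. step_Lagrangian Lm Lp a x (t - h) h) b"
  shows "deriv (\<lambda>x. F x c d (t + h)) b = deriv (\<lambda>x. F a b x t) c"
proof -
  \<comment> \<open>For fixed positive \<open>h\<close> the step contribution is smooth on the whole
    plane of endpoint pairs.\<close>
  define G where "G t z = step_Lagrangian Lm Lp (fst z) (snd z) t h" for t z
  have G: "smooth_on UNIV (G t)" for t
    unfolding G_def step_Lagrangian_def
    by (intro smooth_on_add smooth_on_compose[OF _ open_dom_L smooth(1)]
        smooth_on_compose[OF _ open_dom_L smooth(2)] smooth_map_on_Pair smooth_map_on_real
        smooth_on_divide smooth_on_diff smooth_on_const open_UNIV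
        smooth_on_bounded_linear bounded_linear_fst bounded_linear_snd)
      (use \<open>h > 0\<close> in \<open>auto simp: dom_L_def\<close>)
  define D1 where "D1 t z = frechet_derivative (G t) (at z) (1, 0)" for t z
  define D2 where "D2 t z = frechet_derivative (G t) (at z) (0, 1)" for t z
  note partials = smooth_on_mixed_partials[OF G, folded D1_def D2_def]
  have F: "F a b c t = D1 t (b, c) + D2 (t - h) (a, b)" for a b c t
    using partials(1)[of t c b] partials(2)[of "t - h" a b]
    by (simp add: EL G_def DERIV_imp_deriv)
  obtain m where m: "((\<lambda>r. D1 t (b, r)) has_real_derivative m) (at c)"
      "((\<lambda>s. D2 t (s, c)) has_real_derivative m) (at b)"
    using partials(3)[of t b c] by blast
  have "((\<lambda>x. F x c d (t + h)) has_real_derivative m) (at b)"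
    using DERIV_add[OF DERIV_const m(2)] by (simp add: F)
  moreover have "((\<lambda>x. F a b x t) has_real_derivative m) (at c)"
    using DERIV_add[OF m(1) DERIV_const] by (simp add: F)
  ultimately show ?thesis by (simp add: DERIV_imp_deriv)
qed

section \<open>From the Helmholtz condition to a Lagrangian\<close>

text \<open>All five arguments may vary smoothly: the integrand defining \<open>L\<close> has a
  varying step size, whereas the later calculus keeps it fixed.\<close>

lemma smooth_on_stencil:
  assumes "smooth_on dom_P P" "open S"
    and "smooth_on S a" "smooth_on S b" "smooth_on S c" "smooth_on S t" "smooth_on S h"
    and "\<And>z. z \<in> S \<Longrightarrow> h z > 0"
  shows "smooth_on S (\<lambda>z. P (stencil (a z) (b z) (c z) (t z) (h z)))"
  unfolding stencil_def
  by (intro smooth_on_compose[OF _ open_dom_P assms(1)] smooth_map_on_Pair smooth_map_on_real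
      smooth_on_divide smooth_on_diff assms(2-7))
    (use assms(8) in \<open>force simp: dom_P_def\<close>)+

lemma Helmholtz_imp_Euler_Lagrange:
  assumes P: "smooth_on dom_P P"
    and Helmholtz: "\<And>a b c d t h. h > 0 \<Longrightarrow>
      deriv (\<lambda>x. P (stencil x c d (t + h) h)) b = deriv (\<lambda>x. P (stencil a b x t h)) c"
  obtains L where "smooth_on dom_L L"
    and "\<And>a b c t h. h > 0 \<Longrightarrow>
      P (stencil a b c t h) = deriv (\<lambda>x. step_Lagrangian (\<lambda>_. 0) L x c t h) b
        + deriv (\<lambda>x. step_Lagrangian (\<lambda>_. 0) L a x (t - h) h) b"
proof
  \<comment> \<open>With \<open>z = (x, v, t, \<xi>)\<close>, this is the integral over
    \<open>s\<close> from 0 to \<open>x\<close> of the operator at the values 0, \<open>s\<close>,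
    \<open>x + \<xi> * v\<close>, rescaled to the unit interval.\<close>
  define L where "L z = integral {0..1} (\<lambda>\<tau>. fst z * P (stencil 0 (\<tau> * fst z)
      (fst z + snd (snd (snd z)) * fst (snd z)) (fst (snd (snd z))) (snd (snd (snd z)))))" for z
  have opn: "open (dom_L \<times> (UNIV :: real set))" by (intro open_Times open_dom_L open_UNIV)
  define K where "K y = fst (fst y) * P (stencil 0 (snd y * fst (fst y))
      (fst (fst y) + snd (snd (snd (fst y))) * fst (snd (fst y))) (fst (snd (snd (fst y))))
      (snd (snd (snd (fst y)))))" for y :: "(real \<times> real \<times> real \<times> real) \<times> real"
  have "smooth_on (dom_L \<times> UNIV) K"
    unfolding K_def
    by (intro smooth_on_stencil[OF P] smooth_on_mult smooth_on_add smooth_on_const opn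
        smooth_on_bounded_linear[OF opn] bounded_linear_intros)
      (auto simp: dom_L_def)
  from smooth_on_integral[OF open_dom_L convex_dom_L this] show "smooth_on dom_L L"
    by (simp add: K_def L_def[abs_def])
  fix a b c t h :: real assume h: "h > 0"
  define F where "F a b c t = P (stencil a b c t h)" for a b c t
  define Fv where "Fv t z = F (fst z) (fst (snd z)) (snd (snd z)) t" for t z
  have Fv: "smooth_on UNIV (Fv t)" for t
    unfolding Fv_def F_def
    by (intro smooth_on_stencil[OF P] smooth_on_const smooth_on_bounded_linear open_UNIV bounded_linear_intros)
      (simp add: h)
  define Fc where "Fc t z = frechet_derivative (Fv t) (at z) (0, 0, 1)" for t z
  define Fa where "Fa t z = frechet_derivative (Fv t) (at z) (1, 0, 0)" for t z
  have Fc: "((\<lambda>x. F a b x t) has_real_derivative Fc t (a, b, c)) (at c)" for a b c t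
    using smooth_on_curve[OF Fv[of t], of "\<lambda>x. (a, b, x)" c "(0, 0, 1)"]
    by (simp add: Fv_def Fc_def has_vector_derivative_Pair zero_prod_def[symmetric])
  have Fa: "((\<lambda>x. F x b c t) has_real_derivative Fa t (a, b, c)) (at a)" for a b c t
    using smooth_on_curve[OF Fv[of t], of "\<lambda>x. (x, b, c)" a "(1, 0, 0)"]
    by (simp add: Fv_def Fa_def has_vector_derivative_Pair zero_prod_def[symmetric])
  \<comment> \<open>One side is free of \<open>a\<close>, the other of \<open>d\<close>: hence
    \<open>Fc\<close> does not depend on its first value, nor \<open>Fa\<close> on its last.\<close>
  have helm: "Fa (t + h) (b, c, d) = Fc t (a, b, c)" for a b c d t
    using Helmholtz[OF h, of c d t b a] DERIV_imp_deriv[OF Fc] DERIV_imp_deriv[OF Fa] by (simp add: F_def)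
  have cont: "continuous_on S (\<lambda>x. F (a x) (b x) (c x) t)"
    if "continuous_on S a" "continuous_on S b" "continuous_on S c" for S :: "'z::topological_space set" and a b c t
    using continuous_on_compose2[OF smooth_on_imp_continuous_on[OF Fv[of t]]
        continuous_on_Pair[OF that(1) continuous_on_Pair[OF that(2,3)]]]
    by (simp add: Fv_def)
  have contFc: "continuous_on UNIV (Fc t)" for t
    unfolding Fc_def by (rule smooth_on_imp_continuous_on[OF smooth_on_frechet[OF Fv]])

  define S where "S b c t = integral {0..1} (\<lambda>\<tau>. b * F 0 (\<tau> * b) c t)" for b c t
  \<comment> \<open>At slope \<open>(c - b) / h\<close> the predicted right endpoint
    \<open>b + h * ((c - b) / h)\<close> is \<open>c\<close>.\<close>
  have step: "step_Lagrangian (\<lambda>_. 0) L b c t h = S b c t" for b c t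
    using h by (simp add: step_Lagrangian_def L_def S_def F_def)
  have S1: "((\<lambda>x. S x c t) has_real_derivative F 0 b c t) (at b)" for b c t
    unfolding S_def by (rule has_real_derivative_scaled_integral) (intro cont continuous_intros)
  \<comment> \<open>Differentiating under the integral gives \<open>Fc\<close> at time
    \<open>t - h\<close>; \<open>helm\<close> turns it into \<open>Fa\<close> at time
    \<open>t\<close>, which makes the integrand the \<tau>-derivative of
    \<open>F (\<tau> * a) b 0 t\<close>.\<close>
  have S2: "((\<lambda>x. S a x (t - h)) has_real_derivative F a b 0 t - F 0 b 0 t) (at b)" for a b t
  proof -
    have "((\<lambda>x. integral (cbox 0 1) (\<lambda>\<tau>. a * F 0 (\<tau> * a) x (t - h))) has_real_derivative
        integral (cbox 0 1) (\<lambda>\<tau>. a * Fc (t - h) (0, \<tau> * a, b))) (at b within UNIV)"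
    proof (rule leibniz_rule_field_derivative)
      show "continuous_on (UNIV \<times> cbox 0 1) (\<lambda>(x, \<tau>). a * Fc (t - h) (0, \<tau> * a, x))"
        by (auto simp: case_prod_beta intro!: continuous_intros continuous_on_compose2[OF contFc])
    qed (auto intro!: DERIV_cmult Fc integrable_continuous_interval cont continuous_intros)
    moreover have "integral {0..1} (\<lambda>\<tau>. a * Fc (t - h) (0, \<tau> * a, b)) = F (1 * a) b 0 t - F (0 * a) b 0 t"
    proof (rule integral_unique, rule fundamental_theorem_of_calculus)
      fix \<tau> :: real
      have "((\<lambda>\<tau>. F (\<tau> * a) b 0 t) has_real_derivative Fa t (\<tau> * a, b, 0) * a) (at \<tau>)"
        by (rule DERIV_chain2[OF Fa]) (auto intro!: derivative_eq_intros)
      also have "Fa t (\<tau> * a, b, 0) = Fc (t - h) (0, \<tau> * a, b)"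
        using helm[of "t - h"] by simp
      finally show "((\<lambda>\<tau>. F (\<tau> * a) b 0 t) has_vector_derivative a * Fc (t - h) (0, \<tau> * a, b))
          (at \<tau> within {0..1})"
        by (simp add: has_real_derivative_iff_has_vector_derivative has_vector_derivative_at_within mult.commute)
    qed simp
    ultimately show ?thesis by (simp add: S_def)
  qed
  \<comment> \<open>The difference is constant in the last value, hence equal to its value at 0;
    this lets the sum of \<open>S1\<close> and \<open>S2\<close> collapse to
    \<open>F a b c t\<close>.\<close>
  have "F a b c t - F 0 b c t = F a b 0 t - F 0 b 0 t"
  proof (rule DERIV_isconst_all[where f="\<lambda>c. F a b c t - F 0 b c t", rule_format])
    fix c
    show "((\<lambda>c. F a b c t - F 0 b c t) has_real_derivative 0) (at c)"
      \<comment> \<open>Taking \<open>d = 0\<close> in both instances of \<open>helm\<close> equates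
        the two \<open>Fc\<close> terms with the same \<open>Fa\<close> term.\<close>
      using DERIV_diff[OF Fc[of a b t c] Fc[of 0 b t c]] helm[of t b c 0 a] helm[of t b c 0 0] by simp
  qed
  then show "P (stencil a b c t h) = deriv (\<lambda>x. step_Lagrangian (\<lambda>_. 0) L x c t h) b
        + deriv (\<lambda>x. step_Lagrangian (\<lambda>_. 0) L a x (t - h) h) b"
    by (simp add: step DERIV_imp_deriv[OF S1] DERIV_imp_deriv[OF S2] flip: F_def)
qed

theorem theorem9:
  fixes Pbar :: "real \<times> real \<times> real \<times> real \<times> real \<times> real \<Rightarrow> real"
  assumes "smooth_on dom_P Pbar"
  shows
    "(\<exists>Lm Lp :: real \<times> real \<times> real \<times> real \<Rightarrow> real.
        smooth_on dom_L Lm \<and> smooth_on dom_L Lp \<and>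
        (\<forall>N h t Q. uniform_grid N h t \<longrightarrow>
          (\<forall>p\<in>{1..N - 1}.
             fd_operator Pbar h t Q p =
               dL_dx Lm (ast h t Q p) + dL_dx Lp (astast h t Q p)
               + Delta_plus h (\<lambda>q. dL_dv Lm (ast h t Q q)) p
               - Delta_minus h (\<lambda>q. dL_dv Lp (astast h t Q q)) p)))
     \<longleftrightarrow>
     (\<forall>N h t Q. uniform_grid N h t \<longrightarrow>
        (\<forall>p\<in>{2..N - 1}.
           Delta_minus h (\<lambda>q. dP_dw Pbar (star h t Q q)) p =
             dP_dvm Pbar (star h t Q p) + dP_dvp Pbar (star h t Q (p - 1))))"
  (is "?EL \<longleftrightarrow> _")
  unfolding Helmholtz_iff[OF assms]
proof
  assume ?EL
  then obtain Lm Lp where L: "smooth_on dom_L Lm" "smooth_on dom_L Lp"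
    and EL: "\<forall>N h t Q. uniform_grid N h t \<longrightarrow>
          (\<forall>p\<in>{1..N - 1}.
             fd_operator Pbar h t Q p =
               dL_dx Lm (ast h t Q p) + dL_dx Lp (astast h t Q p)
               + Delta_plus h (\<lambda>q. dL_dv Lm (ast h t Q q)) p
               - Delta_minus h (\<lambda>q. dL_dv Lp (astast h t Q q)) p)"
    by (elim exE conjE)
  show "\<forall>a b c d t h. h > 0 \<longrightarrow>
      deriv (\<lambda>x. Pbar (stencil x c d (t + h) h)) b = deriv (\<lambda>x. Pbar (stencil a b x t h)) c"
  proof (intro allI impI)
    fix a b c d t h :: real assume h: "h > 0"
    show "deriv (\<lambda>x. Pbar (stencil x c d (t + h) h)) b = deriv (\<lambda>x. Pbar (stencil a b x t h)) c"
      by (rule Euler_Lagrange_imp_Helmholtz[OF L h, where F="\<lambda>a b c t. Pbar (stencil a b c t h)"])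
        (rule EL[unfolded Euler_Lagrange_iff[OF L], rule_format, OF h])
  qed
next
  assume H: "\<forall>a b c d t h. h > 0 \<longrightarrow>
      deriv (\<lambda>x. Pbar (stencil x c d (t + h) h)) b = deriv (\<lambda>x. Pbar (stencil a b x t h)) c"
  have zero: "smooth_on dom_L (\<lambda>_. 0)" by (rule smooth_on_const[OF open_dom_L])
  obtain L where L: "smooth_on dom_L L"
    and EL: "\<And>a b c t h. h > 0 \<Longrightarrow>
      Pbar (stencil a b c t h) = deriv (\<lambda>x. step_Lagrangian (\<lambda>_. 0) L x c t h) b
        + deriv (\<lambda>x. step_Lagrangian (\<lambda>_. 0) L a x (t - h) h) b"
    by (rule Helmholtz_imp_Euler_Lagrange[OF assms]) (use H in simp_all)
  show ?EL
    \<comment> \<open>Resolving with \<open>zero\<close> and \<open>L\<close> fixes the witnesses: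
      the zero function for \<open>Lm\<close> and \<open>L\<close> for \<open>Lp\<close>.\<close>
    by (rule exI, rule exI, intro conjI, rule zero, rule L,
        subst Euler_Lagrange_iff[OF zero L]) (intro allI impI EL)
qed

end
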